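(* Let $G$ be a quasi-regularizable graph of order $n=2\alpha$, where $\alpha=\alpha(G)$. Then: (i) $\omega_{\alpha-k}\leq 2(\alpha-k)$ for all integers $0\leq k\leq\alpha$; (ii) $(k+1)\cdot s_{k+1}\leq 2(\alpha-k)\cdot s_{k}$ for all integers $0\leq k<\alpha$; (iii) $s_{\lceil (2\alpha-1)/3\rceil}\geq\cdots\geq s_{\alpha-1}\geq s_{\alpha}$, i.e. $s_{k}\geq s_{k+1}$ for every integer $k$ with $\lceil (2\alpha-1)/3\rceil\leq k<\alpha$.
   Context: All graphs are finite, undirected, without loops or multiple edges. A stable set is a set of pairwise non-adjacent vertices (the empty set is stable). The stability number $\alpha(G)$ is the maximum cardinality of a stable set in $G$, and $s_k$ denotes the number of stable sets of cardinality $k$ in $G$, for $0\leq k\leq\alpha(G)$. For a vertex $v$, $N(v)$ is the set of its neighbors; for a stable set $S$, $N(S)=\{v\in V(G): N(v)\cap S\neq\emptyset\}$ and $N[S]=N(S)\cup S$. For a graph $G$ of order $n$ with $\alpha(G)=\alpha$, and $0\leq k\leq\alpha$, define $$\omega_{\alpha-k}=\max\{\,n-|N[S]| : S \text{ is a stable set of } G \text{ with } |S|=k\,\}.$$ A graph $G$ is quasi-regularizable if one can replace each edge of $G$ with a non-negative integer number of parallel copies so as to obtain a regular multigraph of degree $\neq 0$. *)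

theory Defs
  imports Complex_Main "Graph_Theory.Digraph"
begin

text \<open>
  Finite simple graphs are the symmetric digraphs of the locale \<open>graph\<close>: an undirected edge
  is a pair of opposite arcs, and adjacency is \<open>u \<rightarrow>\<^bsub>G\<^esub> v\<close>.
\<close>

definition edges :: "('a, 'b) pre_digraph \<Rightarrow> 'a set set" where
  "edges G = {{u, v} | u v. u \<rightarrow>\<^bsub>G\<^esub> v}"

definition stable_set :: "('a, 'b) pre_digraph \<Rightarrow> 'a set \<Rightarrow> bool" where
  "stable_set G S \<longleftrightarrow> S \<subseteq> verts G \<and> (\<forall>u\<in>S. \<forall>v\<in>S. \<not> u \<rightarrow>\<^bsub>G\<^esub> v)"

definition stability_number :: "('a, 'b) pre_digraph \<Rightarrow> nat" where
  "stability_number G = Max {card S | S. stable_set G S}"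

definition num_stable_sets :: "('a, 'b) pre_digraph \<Rightarrow> nat \<Rightarrow> nat" where
  "num_stable_sets G k = card {S. stable_set G S \<and> card S = k}"

definition neighbors :: "('a, 'b) pre_digraph \<Rightarrow> 'a \<Rightarrow> 'a set" where
  "neighbors G v = {u \<in> verts G. v \<rightarrow>\<^bsub>G\<^esub> u}"

definition set_neighbors :: "('a, 'b) pre_digraph \<Rightarrow> 'a set \<Rightarrow> 'a set" where
  "set_neighbors G S = {v \<in> verts G. neighbors G v \<inter> S \<noteq> {}}"

definition closed_set_neighbors :: "('a, 'b) pre_digraph \<Rightarrow> 'a set \<Rightarrow> 'a set" where
  "closed_set_neighbors G S = set_neighbors G S \<union> S"

text \<open>
  The argument of \<open>omega\<close> is the subscript \<open>j = \<alpha>(G) - k\<close>, so the stable sets ranged over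
  are those of cardinality \<open>k = \<alpha>(G) - j\<close>. It is meaningful for \<open>j \<le> \<alpha>(G)\<close> only: otherwise
  the maximum is over the empty set. The subtraction is never truncated in a finite graph,
  as a closed neighborhood of a stable set consists of vertices.
\<close>

definition omega :: "('a, 'b) pre_digraph \<Rightarrow> nat \<Rightarrow> nat" where
  "omega G j = Max {card (verts G) - card (closed_set_neighbors G S) | S.
     stable_set G S \<and> card S + j = stability_number G}"

text \<open>The degree of \<open>v\<close> in the multigraph with \<open>m e\<close> parallel copies of each edge \<open>e\<close> of \<open>G\<close>.\<close>

definition multi_degree :: "('a, 'b) pre_digraph \<Rightarrow> ('a set \<Rightarrow> nat) \<Rightarrow> 'a \<Rightarrow> nat" where
  "multi_degree G m v = (\<Sum>e \<in> {e \<in> edges G. v \<in> e}. m e)"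

definition quasi_regularizable :: "('a, 'b) pre_digraph \<Rightarrow> bool" where
  "quasi_regularizable G \<longleftrightarrow>
     (\<exists>m r. r \<noteq> 0 \<and> (\<forall>v \<in> verts G. multi_degree G m v = r))"

end

theory Submission
  imports Defs
begin

text \<open>
  Weighting the edges so that all degrees equal \<open>r > 0\<close> and counting the weight between a stable
  set \<open>S\<close> and its neighborhood from both sides gives \<open>r |S| \<le> r |N(S)|\<close>, so \<open>|N[S]| \<ge> 2 |S|\<close>; this
  is (i). A stable set of size \<open>k\<close> can only be extended by one of the \<open>n - |N[S]| \<le> 2 (\<alpha> - k)\<close>
  vertices outside \<open>N[S]\<close>, and every stable set of size \<open>k + 1\<close> arises from \<open>k + 1\<close> such
  extensions, which yields (ii). Finally \<open>2 (\<alpha> - k) \<le> k + 1\<close> as soon as \<open>k \<ge> (2 \<alpha> - 1) / 3\<close>.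
\<close>

lemma stable_set_subset: "stable_set G T \<Longrightarrow> S \<subseteq> T \<Longrightarrow> stable_set G S"
  unfolding stable_set_def by blast

lemma (in graph) finite_stable_set: "stable_set G S \<Longrightarrow> finite S"
  unfolding stable_set_def using finite_subset[OF _ finite_verts] by blast

lemma (in graph) finite_stable_sets: "finite {S. stable_set G S}"
  by (rule finite_subset[of _ "Pow (verts G)"]) (auto simp: stable_set_def)

lemma (in graph) adj_commute: "u \<rightarrow>\<^bsub>G\<^esub> v \<longleftrightarrow> v \<rightarrow>\<^bsub>G\<^esub> u"
  using sym_arcs by (auto simp: symmetric_def dest: symD)

lemma (in graph) finite_neighbors: "finite (neighbors G v)"
  unfolding neighbors_def by simp

text \<open>An edge at \<open>v\<close> is determined by its other endpoint. Indexing the degree by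
  vertices instead of edges prepares the double count below.\<close>

lemma (in graph) multi_degree_eq_sum_neighbors:
  "multi_degree G m v = (\<Sum>u\<in>neighbors G v. m {v, u})"
proof -
  have "bij_betw (\<lambda>u. {v, u}) (neighbors G v) {e \<in> edges G. v \<in> e}"
  proof (rule bij_betw_imageI)
    show "inj_on (\<lambda>u. {v, u}) (neighbors G v)"
      by (auto simp: inj_on_def doubleton_eq_iff)
    show "(\<lambda>u. {v, u}) ` neighbors G v = {e \<in> edges G. v \<in> e}" (is "?L = ?R")
    proof
      show "?L \<subseteq> ?R"
        by (auto simp: neighbors_def edges_def)
      show "?R \<subseteq> ?L"
      proof
        fix e assume "e \<in> ?R"
        then obtain u where u: "e = {v, u}" "v \<rightarrow>\<^bsub>G\<^esub> u"
          using adj_commute by (auto simp: edges_def insert_commute)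
        then have "u \<in> neighbors G v"
          using adj_in_verts(2) by (simp add: neighbors_def)
        then show "e \<in> ?L" using u(1) by blast
      qed
    qed
  qed
  then show ?thesis
    unfolding multi_degree_def by (rule sum.reindex_bij_betw[symmetric])
qed

lemma (in graph) stable_set_card_le_neighbors:
  assumes "quasi_regularizable G" and S: "stable_set G S"
  shows "card S \<le> card (set_neighbors G S)"
proof -
  obtain m r where r: "r \<noteq> 0" and deg: "\<And>v. v \<in> verts G \<Longrightarrow> multi_degree G m v = r"
    using assms(1) unfolding quasi_regularizable_def by blast
  let ?N = "set_neighbors G S"
  \<comment> \<open>Giving non-adjacent pairs weight 0 lets both counts range over the full product
    of \<open>S\<close> and \<open>?N\<close>, so that the two sums can be swapped.\<close>
  let ?w = "\<lambda>v u. if v \<rightarrow>\<^bsub>G\<^esub> u then m {v, u} else 0"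
  have fin: "finite S" "finite ?N"
    using S by (auto simp: finite_stable_set set_neighbors_def)
  have SV: "S \<subseteq> verts G" using S by (simp add: stable_set_def)
  have "card S * r = (\<Sum>v\<in>S. \<Sum>u\<in>neighbors G v. m {v, u})"
    using SV deg by (simp add: multi_degree_eq_sum_neighbors[symmetric] subset_iff)
  also have "\<dots> = (\<Sum>v\<in>S. \<Sum>u\<in>?N. ?w v u)"
  \<comment> \<open>Every neighbor of a vertex of \<open>S\<close> lies in \<open>?N\<close>, so
    enlarging the index set only adds zero terms.\<close>
  proof (rule sum.cong[OF refl])
    fix v assume "v \<in> S"
    then show "(\<Sum>u\<in>neighbors G v. m {v, u}) = (\<Sum>u\<in>?N. ?w v u)"
      using fin SV adj_commute
      by (intro sum.mono_neutral_cong_left)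
        (auto simp: set_neighbors_def neighbors_def)
  qed
  also have "\<dots> = (\<Sum>u\<in>?N. \<Sum>v\<in>S. ?w v u)"
    by (rule sum.swap)
  also have "\<dots> \<le> (\<Sum>u\<in>?N. multi_degree G m u)"
  proof (rule sum_mono)
    \<comment> \<open>The inequality arises here: edges from \<open>u\<close> into \<open>S\<close>
      are only some of the edges at \<open>u\<close>.\<close>
    fix u
    have "(\<Sum>v\<in>S. ?w v u) = (\<Sum>v\<in>S \<inter> neighbors G u. m {u, v})"
      using fin SV adj_commute
      by (intro sum.mono_neutral_cong_right) (auto simp: neighbors_def insert_commute)
    also have "\<dots> \<le> (\<Sum>v\<in>neighbors G u. m {u, v})"
      by (rule sum_mono2) (auto simp: finite_neighbors)
    finally show "(\<Sum>v\<in>S. ?w v u) \<le> multi_degree G m u"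
      by (simp add: multi_degree_eq_sum_neighbors)
  qed
  also have "\<dots> = card ?N * r"
    using deg by (simp add: set_neighbors_def)
  finally show ?thesis using r by simp
qed

text \<open>Stability makes \<open>S\<close> disjoint from its neighborhood, so the cardinalities
  add up.\<close>

lemma (in graph) closed_set_neighbors_card_ge:
  assumes "quasi_regularizable G" and S: "stable_set G S"
  shows "2 * card S \<le> card (closed_set_neighbors G S)"
proof -
  have "set_neighbors G S \<inter> S = {}"
    using S by (auto simp: set_neighbors_def neighbors_def stable_set_def)
  moreover have "finite (set_neighbors G S)"
    by (simp add: set_neighbors_def)
  ultimately show ?thesis
    using stable_set_card_le_neighbors[OF assms] finite_stable_set[OF S]
    by (simp add: closed_set_neighbors_def card_Un_disjoint)
qed

text \<open>A maximum stable set has subsets of every smaller size, and these are stable. This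
  ensures that the \<open>Max\<close> in \<open>omega\<close> is over a nonempty set.\<close>

lemma (in graph) exists_stable_set:
  assumes "k \<le> stability_number G"
  shows "\<exists>S. stable_set G S \<and> card S = k"
proof -
  have "stability_number G \<in> {card S | S. stable_set G S}"
    unfolding stability_number_def
  proof (rule Max_in)
    show "finite {card S | S. stable_set G S}"
      using finite_imageI[OF finite_stable_sets, of card] by (simp add: setcompr_eq_image)
    show "{card S | S. stable_set G S} \<noteq> {}"
      by (auto simp: stable_set_def)
  qed
  then obtain T where T: "stable_set G T" "card T = stability_number G" by auto
  then obtain S where "S \<subseteq> T" "card S = k"
    using assms obtain_subset_with_card_n by metis
  then show ?thesis using T(1) stable_set_subset by blast
qed

lemma (in graph) omega_le:
  assumes qr: "quasi_regularizable G" and n: "card (verts G) = 2 * stability_number G"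
    and j: "j \<le> stability_number G"
  shows "omega G j \<le> 2 * j"
proof -
  let ?X = "{card (verts G) - card (closed_set_neighbors G S) | S.
     stable_set G S \<and> card S + j = stability_number G}"
  have "finite ?X"
    by (rule finite_subset[of _ "{..card (verts G)}"]) auto
  moreover have "?X \<noteq> {}"
    using exists_stable_set[of "stability_number G - j"] j by fastforce
  \<comment> \<open>Here |S| = \<alpha> - j, so n - |N[S]| \<le> 2 \<alpha> - 2 (\<alpha> - j) = 2
    j.\<close>
  moreover have "x \<le> 2 * j" if "x \<in> ?X" for x
    using that closed_set_neighbors_card_ge[OF qr] n by fastforce
  ultimately show ?thesis by (simp add: omega_def)
qed

lemma (in graph) Suc_mult_num_stable_sets_le:
  assumes "\<And>S. stable_set G S \<Longrightarrow> card S = k \<Longrightarrow> card (verts G) - card (closed_set_neighbors G S) \<le> d"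
  shows "(k + 1) * num_stable_sets G (k + 1) \<le> d * num_stable_sets G k"
proof -
  let ?A = "\<lambda>k. {S. stable_set G S \<and> card S = k}"
  let ?ext = "\<lambda>S. verts G - closed_set_neighbors G S"
  have fin: "finite (?A i)" for i
    by (rule finite_subset[OF _ finite_stable_sets]) blast
  \<comment> \<open>Count pairs of a stable set of size k + 1 and a distinguished element of
    it.\<close>
  have "(k + 1) * num_stable_sets G (k + 1) = card (SIGMA T:?A (k + 1). T)"
    using fin by (subst card_SigmaI) (auto simp: num_stable_sets_def finite_stable_set)
  also have "\<dots> \<le> card (SIGMA S:?A k. ?ext S)"
  \<comment> \<open>As \<open>T\<close> is stable, \<open>x\<close> is neither in
    \<open>T - {x}\<close> nor adjacent to it, so it avoids the closed neighborhood. Keeping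
    \<open>x\<close> in the image makes the map injective: \<open>T\<close> is recovered by
    reinserting it.\<close>
  proof (rule card_inj_on_le[where f = "\<lambda>(T, x). (T - {x}, x)"])
    show "inj_on (\<lambda>(T, x). (T - {x}, x)) (SIGMA T:?A (k + 1). T)"
      by (auto simp: inj_on_def)
    show "(\<lambda>(T, x). (T - {x}, x)) ` (SIGMA T:?A (k + 1). T) \<subseteq> (SIGMA S:?A k. ?ext S)"
      by (auto simp: stable_set_def closed_set_neighbors_def set_neighbors_def neighbors_def)
    show "finite (SIGMA S:?A k. ?ext S)"
      using fin by (intro finite_SigmaI) auto
  qed
  also have "\<dots> = (\<Sum>S\<in>?A k. card (?ext S))"
    using fin by (subst card_SigmaI) auto
  also have "\<dots> \<le> (\<Sum>S\<in>?A k. d)"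
  proof (rule sum_mono)
    fix S assume S: "S \<in> ?A k"
    then have "closed_set_neighbors G S \<subseteq> verts G"
      by (auto simp: closed_set_neighbors_def set_neighbors_def stable_set_def)
    then have "card (?ext S) = card (verts G) - card (closed_set_neighbors G S)"
      by (meson card_Diff_subset finite_subset finite_verts)
    then show "card (?ext S) \<le> d" using assms S by simp
  qed
  also have "\<dots> = d * num_stable_sets G k"
    by (simp add: num_stable_sets_def)
  finally show ?thesis .
qed

theorem proposition2p4:
  fixes G :: "('a, 'b) pre_digraph" and \<alpha> :: nat
  assumes "graph G"
    and "quasi_regularizable G"
    and "\<alpha> = stability_number G"
    and "card (verts G) = 2 * \<alpha>"
  shows "(\<forall>k::nat. k \<le> \<alpha> \<longrightarrow> omega G (\<alpha> - k) \<le> 2 * (\<alpha> - k))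
    \<and> (\<forall>k::nat. k < \<alpha> \<longrightarrow>
         (k + 1) * num_stable_sets G (k + 1) \<le> 2 * (\<alpha> - k) * num_stable_sets G k)
    \<and> (\<forall>k::nat. \<lceil>(2 * real \<alpha> - 1) / 3\<rceil> \<le> int k \<and> k < \<alpha> \<longrightarrow>
         num_stable_sets G (k + 1) \<le> num_stable_sets G k)"
proof -
  interpret graph G by fact
  have i: "omega G (\<alpha> - k) \<le> 2 * (\<alpha> - k)" for k
    using omega_le[OF assms(2)] assms(3,4) by simp
  have ii: "(k + 1) * num_stable_sets G (k + 1) \<le> 2 * (\<alpha> - k) * num_stable_sets G k" for k
    using closed_set_neighbors_card_ge[OF assms(2)] assms(4)
    by (intro Suc_mult_num_stable_sets_le) fastforce
  have iii: "num_stable_sets G (k + 1) \<le> num_stable_sets G k"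
    if "\<lceil>(2 * real \<alpha> - 1) / 3\<rceil> \<le> int k" for k
  proof -
    \<comment> \<open>The ceiling bound amounts to 2 \<alpha> - 1 \<le> 3 k.\<close>
    have "2 * (\<alpha> - k) \<le> k + 1"
      using that by (simp add: ceiling_le_iff field_simps)
    then have "(k + 1) * num_stable_sets G (k + 1) \<le> (k + 1) * num_stable_sets G k"
      using ii[of k] mult_le_mono1 order_trans by blast
    then show ?thesis by (simp only: mult_le_cancel1)
  qed
  show ?thesis using i ii iii by blast
qed

end
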